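(* Let $n\ge 1$ and $1<p<\infty$. Let $\Omega\subset\mathbb{R}^n$ be a domain and $T>0$ be such that $\Omega_T=\Omega\times(0,T)\subset\mathbb{R}^{n+1}$ has finite measure. Let $0\le\gamma<1$ and $0<r<\infty$, and assume that $f\in L^r_{\mathrm{loc}}(\Omega_T)$. Then \[ \lim_{q\to\infty}\|f\|_{PJN_{q,\gamma,r}^{+}(\Omega_T)}=\|f\|_{\mathrm{PBMO}_{\gamma,r}^{+}(\Omega_T)}, \] where both sides are understood as elements of $[0,\infty]$.
   Context: Points of $\mathbb{R}^{n+1}$ are written $(x,t)$ with $x\in\mathbb{R}^n$, $t\in\mathbb{R}$; $|A|$ is the Lebesgue measure of $A\subset\mathbb{R}^{n+1}$. Positive and negative parts: $g_+=\max\{g,0\}$, $g_-=-\min\{g,0\}$; $(f-c)_\pm^r$ means $((f-c)_\pm)^r$. A domain is a nonempty connected open set. The exponent $1<p<\infty$ is fixed. For $x\in\mathbb{R}^n$, $L>0$, let $Q(x,L)=\{y\in\mathbb{R}^n:|y_i-x_i|\le L,\ i=1,\dots,n\}$. For $t\in\mathbb{R}$, the parabolic rectangle centered at $(x,t)$ with edge length $L$ is \[ R=R(x,t,L)=Q(x,L)\times(t-L^p,t+L^p), \] and for $-1<\gamma<1$ (the time lag) its upper and lower parts are \[ R^+(\gamma)=Q(x,L)\times(t+\gamma L^p,t+L^p),\qquad R^-(\gamma)=Q(x,L)\times(t-L^p,t-\gamma L^p). \] For a parabolic rectangle $R\subset\Omega_T$, $c\in\mathbb{R}$, put \[ E_R(c)=\frac1{|R^+(\gamma)|}\int_{R^+(\gamma)}(f-c)_+^r\,dx\,dt+\frac1{|R^-(\gamma)|}\int_{R^-(\gamma)}(f-c)_-^r\,dx\,dt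 . \] The parabolic BMO norm is \[ \|f\|_{\mathrm{PBMO}_{\gamma,r}^{+}(\Omega_T)}=\sup_{R\subset\Omega_T}\inf_{c\in\mathbb{R}}E_R(c)^{1/r}\in[0,\infty], \] the supremum being over all parabolic rectangles $R\subset\Omega_T$. For $1<q<\infty$ with $r<q$, the parabolic John--Nirenberg norm is \[ \|f\|_{PJN_{q,\gamma,r}^{+}(\Omega_T)}=\Bigl(\sup\sum_{i}|R_i^+(\gamma)|\inf_{c\in\mathbb{R}}E_{R_i}(c)^{q/r}\Bigr)^{1/q}\in[0,\infty], \] the supremum being over all countable collections $\{R_i\}$ of pairwise disjoint parabolic rectangles contained in $\Omega_T$. *)

theory Defs
  imports "HOL-Analysis.Analysis"
begin

type_synonym 'n spacetime = "(real ^ 'n) \<times> real"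

definition ennreal_powr :: "ennreal \<Rightarrow> real \<Rightarrow> ennreal" where
  \<comment> \<open>Only used for exponents \<open>a > 0\<close>; there \<open>0\<close> is mapped to \<open>0\<close> and \<open>\<infinity>\<close> to \<open>\<infinity>\<close>.\<close>
  "ennreal_powr u a = (if u = \<infinity> then \<infinity> else ennreal (enn2real u powr a))"

definition cyl :: "(real ^ 'n) set \<Rightarrow> real \<Rightarrow> 'n spacetime set" where
  "cyl \<Omega> T = \<Omega> \<times> {0<..<T}"

definition Lr_loc :: "real \<Rightarrow> 'n::finite spacetime set \<Rightarrow> ('n spacetime \<Rightarrow> real) \<Rightarrow> bool" where
  "Lr_loc r U f \<longleftrightarrow> f \<in> borel_measurable (lebesgue_on U) \<and>
     (\<forall>K. compact K \<and> K \<subseteq> U \<longrightarrow>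
        (\<integral>\<^sup>+z\<in>K. ennreal (\<bar>f z\<bar> powr r) \<partial>lebesgue) < \<infinity>)"

definition cube :: "real ^ 'n \<Rightarrow> real \<Rightarrow> (real ^ 'n) set" where
  "cube x L = {y. \<forall>i. \<bar>y $ i - x $ i\<bar> \<le> L}"

text \<open>A parabolic rectangle is represented by its parameters \<open>(x, t, L)\<close>, which for \<open>L > 0\<close>
  are determined by the underlying point set \<^term>\<open>Rect p (x, t, L)\<close>.\<close>

fun Rect :: "real \<Rightarrow> (real ^ 'n) \<times> real \<times> real \<Rightarrow> 'n spacetime set" where
  "Rect p (x, t, L) = cube x L \<times> {t - L powr p <..< t + L powr p}"

fun Rect_upper :: "real \<Rightarrow> real \<Rightarrow> (real ^ 'n) \<times> real \<times> real \<Rightarrow> 'n spacetime set" where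
  "Rect_upper p \<gamma> (x, t, L) = cube x L \<times> {t + \<gamma> * L powr p <..< t + L powr p}"

fun Rect_lower :: "real \<Rightarrow> real \<Rightarrow> (real ^ 'n) \<times> real \<times> real \<Rightarrow> 'n spacetime set" where
  "Rect_lower p \<gamma> (x, t, L) = cube x L \<times> {t - L powr p <..< t - \<gamma> * L powr p}"

definition Rects :: "real \<Rightarrow> 'n spacetime set \<Rightarrow> ((real ^ 'n) \<times> real \<times> real) set" where
  "Rects p U = {(x, t, L). 0 < L \<and> Rect p (x, t, L) \<subseteq> U}"

text \<open>The averages are taken in \<^typ>\<open>ennreal\<close>: the closure of a parabolic rectangle contained in a
  space-time cylinder may touch the boundary of the cylinder, so they need not be finite.\<close>

definition osc ::
  "real \<Rightarrow> real \<Rightarrow> real \<Rightarrow> ('n::finite spacetime \<Rightarrow> real) \<Rightarrow> (real ^ 'n) \<times> real \<times> real \<Rightarrow> real \<Rightarrow> ennreal"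
where
  "osc p \<gamma> r f R c =
     (\<integral>\<^sup>+z\<in>Rect_upper p \<gamma> R. ennreal (max (f z - c) 0 powr r) \<partial>lebesgue)
        / emeasure lebesgue (Rect_upper p \<gamma> R)
   + (\<integral>\<^sup>+z\<in>Rect_lower p \<gamma> R. ennreal ((- min (f z - c) 0) powr r) \<partial>lebesgue)
        / emeasure lebesgue (Rect_lower p \<gamma> R)"

definition PBMO ::
  "real \<Rightarrow> real \<Rightarrow> real \<Rightarrow> 'n::finite spacetime set \<Rightarrow> ('n spacetime \<Rightarrow> real) \<Rightarrow> ennreal"
where
  "PBMO p \<gamma> r U f = (SUP R \<in> Rects p U. INF c. ennreal_powr (osc p \<gamma> r f R c) (1 / r))"

definition PJN ::
  "real \<Rightarrow> real \<Rightarrow> real \<Rightarrow> real \<Rightarrow> 'n::finite spacetime set \<Rightarrow> ('n spacetime \<Rightarrow> real) \<Rightarrow> ennreal"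
where
  "PJN p q \<gamma> r U f = ennreal_powr
     (SUP C \<in> {C. countable C \<and> C \<subseteq> Rects p U \<and> disjoint_family_on (Rect p) C}.
        \<Sum>\<^sub>\<infinity>R\<in>C. emeasure lebesgue (Rect_upper p \<gamma> R)
                  * (INF c. ennreal_powr (osc p \<gamma> r f R c) (q / r)))
     (1 / q)"

end

theory Submission
  imports Defs
begin

text \<open>
  The statement is the parabolic version of the fact that \<open>L\<^sup>q\<close> norms over a space of finite
  measure tend to the \<open>L\<^sup>\<infinity>\<close> norm. Write \<open>|A|\<close> for Lebesgue measure and \<open>osc(R)\<close> for the
  infimum over \<open>c\<close> of \<^term>\<open>ennreal_powr (osc p \<gamma> r f R c) (1 / r)\<close>. The two sides are compared
  with an arbitrary real number \<open>b \<ge> 0\<close>.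

  If the PBMO norm is below \<open>b\<close>, then every \<open>osc(R)\<close> is below \<open>b\<close>, so each admissible sum is at
  most \<open>b\<^sup>q\<close> times the total measure of the disjoint sets \<open>R\<^sup>+(\<gamma>)\<close>, which is at most the measure
  of the domain. This gives \<open>PJN\<^sub>q \<le> b |\<Omega>\<^sub>T|\<^bsup>1/q\<^esup>\<close> (\<open>PJN_le\<close>).

  If the PBMO norm is above \<open>b\<close>, then \<open>osc(R) > b\<close> for some rectangle, and testing
  with the one-element collection \<open>{R}\<close> gives \<open>PJN\<^sub>q \<ge> b |R\<^sup>+(\<gamma>)|\<^bsup>1/q\<^esup>\<close> (\<open>PJN_ge\<close>).

  Since \<open>m\<^bsup>1/q\<^esup> \<rightarrow> 1\<close> for each \<open>0 < m < \<infinity>\<close>, every \<open>b\<close> on either side of the PBMO norm is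
  eventually a bound for \<open>PJN\<^sub>q\<close>, up to an arbitrarily small error. Taking \<open>b\<close> real makes
  this argument cover infinite norms as well.
\<close>

section \<open>Powers of extended nonnegative reals\<close>

lemma ennreal_powr_ennreal:
  "0 \<le> x \<Longrightarrow> ennreal_powr (ennreal x) a = ennreal (x powr a)"
  by (simp add: ennreal_powr_def)

lemma ennreal_powr_mono:
  assumes "u \<le> v" "0 < a"
  shows "ennreal_powr u a \<le> ennreal_powr v a"
proof (cases v)
  case (real y)
  with assms(1) obtain x where "u = ennreal x" "0 \<le> x"
    by (cases u) (auto simp: top_unique)
  with real assms show ?thesis
    by (auto simp: ennreal_powr_ennreal intro!: ennreal_leI powr_mono2)
qed (simp add: ennreal_powr_def)

lemma ennreal_powr_powr:
  "ennreal_powr (ennreal_powr u a) b = ennreal_powr u (a * b)"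
  by (cases u) (auto simp: ennreal_powr_def powr_powr)

text \<open>The normalisation shared by the upper and the lower estimate: the \<open>q\<close>-th root of
  \<open>m b\<^sup>q\<close> is \<open>b m\<^bsup>1/q\<^esup>\<close>.\<close>

lemma ennreal_powr_root_mult_power:
  assumes "0 \<le> m" "0 \<le> b" "0 < q"
  shows "ennreal_powr (ennreal m * ennreal (b powr q)) (1 / q) = ennreal (b * m powr (1 / q))"
  using assms
  by (simp add: ennreal_mult[symmetric] ennreal_powr_ennreal powr_mult powr_powr mult.commute)

lemma tendsto_mult_powr_inverse_at_top:
  assumes "0 < m" "0 \<le> (b::real)"
  shows "((\<lambda>q. ennreal (b * m powr (1 / q))) \<longlongrightarrow> ennreal b) at_top"
proof -
  have "((\<lambda>q::real. 1 / q) \<longlongrightarrow> 0) at_top"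
    by (intro tendsto_divide_0[OF tendsto_const] filterlim_at_top_imp_at_infinity filterlim_ident)
  then have "((\<lambda>q. b * m powr (1 / q)) \<longlongrightarrow> b * m powr 0) at_top"
    using assms by (intro tendsto_mult tendsto_const tendsto_powr) auto
  with assms show ?thesis
    by (intro tendsto_ennrealI) simp
qed

section \<open>Parabolic rectangles and their upper parts\<close>

lemma closed_cube: "closed (cube x L)"
  unfolding cube_def by (intro closed_Collect_all closed_Collect_le continuous_intros)

lemma ball_subset_cube: "ball x L \<subseteq> cube x L"
proof
  fix y assume "y \<in> ball x L"
  then have "norm (y - x) < L"
    by (simp add: dist_norm norm_minus_commute)
  then have "\<bar>y $ i - x $ i\<bar> \<le> L" for i
    using component_le_norm_cart[of "y - x" i] by simp
  then show "y \<in> cube x L"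
    by (simp add: cube_def)
qed

lemma Rect_upper_measurable: "Rect_upper p \<gamma> R \<in> sets lebesgue"
proof (cases R)
  case (fields x t L)
  have "cube x L \<times> {t + \<gamma> * L powr p<..<t + L powr p} \<in> sets borel"
    by (intro borel_Times borel_closed closed_cube borel_open open_greaterThanLessThan)
  then show ?thesis
    using fields by simp
qed

lemma Rect_upper_subset_Rect:
  assumes "0 \<le> \<gamma>"
  shows "Rect_upper p \<gamma> R \<subseteq> Rect p R"
proof (cases R)
  case (fields x t L)
  have "0 \<le> \<gamma> * L powr p" "0 \<le> L powr p"
    using assms by simp_all
  then have "t - L powr p \<le> t + \<gamma> * L powr p"
    by linarith
  then show ?thesis
    unfolding fields Rect_upper.simps Rect.simps
    by (intro Sigma_mono order_refl greaterThanLessThan_subseteq_greaterThanLessThan[THEN iffD2]) simp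
qed

lemma Rect_upper_subset:
  assumes "0 \<le> \<gamma>" "R \<in> Rects p U"
  shows "Rect_upper p \<gamma> R \<subseteq> U"
proof -
  have "Rect p R \<subseteq> U"
    using assms(2) unfolding Rects_def by blast
  with Rect_upper_subset_Rect[OF assms(1)] show ?thesis
    by (rule subset_trans)
qed

text \<open>A time lag \<open>\<gamma> < 1\<close> leaves room in the time direction, so the upper part contains a nonempty
  open set.\<close>

lemma emeasure_Rect_upper_pos:
  assumes "R \<in> Rects p U" "\<gamma> < 1"
  shows "0 < emeasure lebesgue (Rect_upper p \<gamma> R)"
proof (cases R)
  case (fields x t L)
  let ?I = "{t + \<gamma> * L powr p<..<t + L powr p}"
  have "0 < L"
    using assms fields by (simp add: Rects_def)
  then have "?I \<noteq> {}" "x \<in> ball x L"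
    using assms by auto
  then have "\<not> negligible (ball x L \<times> ?I)"
    by (intro open_not_negligible open_Times) auto
  moreover have "ball x L \<times> ?I \<subseteq> Rect_upper p \<gamma> R"
    unfolding fields Rect_upper.simps by (intro Sigma_mono ball_subset_cube order_refl)
  ultimately have "\<not> negligible (Rect_upper p \<gamma> R)"
    using negligible_subset by blast
  then show ?thesis
    using Rect_upper_measurable[of p \<gamma> R]
    by (auto simp: negligible_iff_null_sets null_sets_def zero_less_iff_neq_zero)
qed

lemma sum_emeasure_Rect_upper_le:
  assumes "0 \<le> \<gamma>" "open U" "finite F" "F \<subseteq> Rects p U" "disjoint_family_on (Rect p) F"
  shows "(\<Sum>R\<in>F. emeasure lebesgue (Rect_upper p \<gamma> R)) \<le> emeasure lebesgue U"
proof -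
  have disj: "disjoint_family_on (Rect_upper p \<gamma>) F"
    using assms(5) Rect_upper_subset_Rect[OF assms(1)]
    unfolding disjoint_family_on_def by blast
  have sub: "(\<Union>R\<in>F. Rect_upper p \<gamma> R) \<subseteq> U"
    using assms(4) Rect_upper_subset[OF assms(1)] by blast
  have "(\<Sum>R\<in>F. emeasure lebesgue (Rect_upper p \<gamma> R))
      = emeasure lebesgue (\<Union>R\<in>F. Rect_upper p \<gamma> R)"
    using assms(3) disj Rect_upper_measurable by (intro sum_emeasure) auto
  also have "\<dots> \<le> emeasure lebesgue U"
    using assms(2) sub by (intro emeasure_mono) auto
  finally show ?thesis .
qed

section \<open>Comparison of the two norms\<close>

text \<open>All oscillations lie below \<open>b\<close>, and the upper parts of disjoint rectangles in \<open>U\<close> have total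
  measure at most \<open>M\<close>. For nonnegative terms the infinite sum is the supremum of the finite
  partial sums, so finite collections suffice.\<close>

lemma PJN_le:
  fixes U :: "'n::finite spacetime set"
  assumes "0 \<le> \<gamma>" "0 < q" "open U" "emeasure lebesgue U \<le> ennreal M" "0 \<le> M"
    and "PBMO p \<gamma> r U f < ennreal b" "0 < b"
  shows "PJN p q \<gamma> r U f \<le> ennreal (b * M powr (1 / q))"
proof -
  have osc_le: "(INF c. ennreal_powr (osc p \<gamma> r f R c) (q / r)) \<le> ennreal (b powr q)"
    if "R \<in> Rects p U" for R
  proof -
    have "(INF c. ennreal_powr (osc p \<gamma> r f R c) (1 / r)) < ennreal b"
      using that assms(6) unfolding PBMO_def by (meson SUP_upper order.strict_trans1)
    then obtain c where c: "ennreal_powr (osc p \<gamma> r f R c) (1 / r) < ennreal b"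
      by (auto simp: INF_less_iff)
    have "ennreal_powr (osc p \<gamma> r f R c) (q / r)
        = ennreal_powr (ennreal_powr (osc p \<gamma> r f R c) (1 / r)) q"
      by (simp add: ennreal_powr_powr)
    also have "\<dots> \<le> ennreal_powr (ennreal b) q"
      using c assms by (intro ennreal_powr_mono) auto
    finally show ?thesis
      using assms(7) by (intro INF_lower2[of c]) (auto simp: ennreal_powr_ennreal)
  qed
  have "(\<Sum>\<^sub>\<infinity>R\<in>C. emeasure lebesgue (Rect_upper p \<gamma> R)
            * (INF c. ennreal_powr (osc p \<gamma> r f R c) (q / r)))
      \<le> ennreal M * ennreal (b powr q)"
    if C: "C \<subseteq> Rects p U" "disjoint_family_on (Rect p) C" for C
  proof -
    have "(\<Sum>R\<in>F. emeasure lebesgue (Rect_upper p \<gamma> R)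
            * (INF c. ennreal_powr (osc p \<gamma> r f R c) (q / r)))
        \<le> ennreal M * ennreal (b powr q)" if F: "finite F" "F \<subseteq> C" for F
    proof -
      have "(\<Sum>R\<in>F. emeasure lebesgue (Rect_upper p \<gamma> R)
            * (INF c. ennreal_powr (osc p \<gamma> r f R c) (q / r)))
          \<le> (\<Sum>R\<in>F. emeasure lebesgue (Rect_upper p \<gamma> R) * ennreal (b powr q))"
        using C F by (intro sum_mono mult_left_mono osc_le) auto
      also have "\<dots> = (\<Sum>R\<in>F. emeasure lebesgue (Rect_upper p \<gamma> R)) * ennreal (b powr q)"
        by (simp add: sum_distrib_right)
      also have "\<dots> \<le> emeasure lebesgue U * ennreal (b powr q)"
        using C F assms(1,3)
        by (intro mult_right_mono sum_emeasure_Rect_upper_le)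
           (auto intro: disjoint_family_on_mono)
      also have "\<dots> \<le> ennreal M * ennreal (b powr q)"
        using assms(4) by (intro mult_right_mono) auto
      finally show ?thesis .
    qed
    then show ?thesis
      by (subst nonneg_infsum_complete) (auto intro!: SUP_least)
  qed
  then have "PJN p q \<gamma> r U f \<le> ennreal_powr (ennreal M * ennreal (b powr q)) (1 / q)"
    unfolding PJN_def using assms(2) by (intro ennreal_powr_mono SUP_least) auto
  then show ?thesis
    using assms by (simp add: ennreal_powr_root_mult_power)
qed

text \<open>The collection consisting of one rectangle \<open>R\<close> is admissible.\<close>

lemma PJN_ge:
  fixes U :: "'n::finite spacetime set"
  assumes "0 < q" "R \<in> Rects p U"
    and "emeasure lebesgue (Rect_upper p \<gamma> R) = ennreal m" "0 \<le> m"
    and "ennreal b \<le> (INF c. ennreal_powr (osc p \<gamma> r f R c) (1 / r))" "0 \<le> b"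
  shows "ennreal (b * m powr (1 / q)) \<le> PJN p q \<gamma> r U f"
proof -
  have "ennreal (b powr q) \<le> ennreal_powr (osc p \<gamma> r f R c) (q / r)" for c
  proof -
    have "ennreal b \<le> ennreal_powr (osc p \<gamma> r f R c) (1 / r)"
      using assms(5) by (simp add: le_INF_iff)
    then have "ennreal_powr (ennreal b) q
        \<le> ennreal_powr (ennreal_powr (osc p \<gamma> r f R c) (1 / r)) q"
      using assms(1) by (rule ennreal_powr_mono)
    then show ?thesis
      using assms(6) by (simp add: ennreal_powr_powr ennreal_powr_ennreal)
  qed
  then have "ennreal m * ennreal (b powr q)
      \<le> emeasure lebesgue (Rect_upper p \<gamma> R)
         * (INF c. ennreal_powr (osc p \<gamma> r f R c) (q / r))"
    unfolding assms(3) by (intro mult_left_mono INF_greatest) auto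
  also have "\<dots> = (\<Sum>\<^sub>\<infinity>R\<in>{R}. emeasure lebesgue (Rect_upper p \<gamma> R)
         * (INF c. ennreal_powr (osc p \<gamma> r f R c) (q / r)))"
    by simp
  also have "\<dots> \<le> (SUP C \<in> {C. countable C \<and> C \<subseteq> Rects p U \<and> disjoint_family_on (Rect p) C}.
        \<Sum>\<^sub>\<infinity>R\<in>C. emeasure lebesgue (Rect_upper p \<gamma> R)
         * (INF c. ennreal_powr (osc p \<gamma> r f R c) (q / r)))"
    using assms(2) by (intro SUP_upper) (simp add: disjoint_family_on_def)
  finally have "ennreal_powr (ennreal m * ennreal (b powr q)) (1 / q) \<le> PJN p q \<gamma> r U f"
    unfolding PJN_def using assms(1) by (intro ennreal_powr_mono) auto
  then show ?thesis
    using assms by (simp add: ennreal_powr_root_mult_power)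
qed

theorem proposition2p8:
  fixes \<Omega> :: "(real ^ 'n::finite) set" and f :: "(real ^ 'n) \<times> real \<Rightarrow> real"
    and p T \<gamma> r :: real
  assumes "1 < p"
    and "open \<Omega>" "connected \<Omega>" "\<Omega> \<noteq> {}"
    and "0 < T" "emeasure lebesgue (cyl \<Omega> T) < \<infinity>"
    and "0 \<le> \<gamma>" "\<gamma> < 1" "0 < r"
    and "Lr_loc r (cyl \<Omega> T) f"
  shows "((\<lambda>q. PJN p q \<gamma> r (cyl \<Omega> T) f) \<longlongrightarrow> PBMO p \<gamma> r (cyl \<Omega> T) f) at_top"
proof (rule order_tendstoI)
  let ?U = "cyl \<Omega> T"
  have U: "open ?U"
    using assms(2) by (auto simp: cyl_def intro: open_Times)
  {
    fix a assume "a < PBMO p \<gamma> r ?U f"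
    then obtain b' where b': "a < b'" "b' < PBMO p \<gamma> r ?U f"
      using dense by blast
    then obtain b where b: "b' = ennreal b" "0 \<le> b"
      by (cases b') auto
    from b' b obtain R where R: "R \<in> Rects p ?U"
        "ennreal b < (INF c. ennreal_powr (osc p \<gamma> r f R c) (1 / r))"
      by (auto simp: PBMO_def less_SUP_iff)
    have "Rect_upper p \<gamma> R \<subseteq> ?U"
      using assms(7) R(1) by (rule Rect_upper_subset)
    then have "emeasure lebesgue (Rect_upper p \<gamma> R) \<le> emeasure lebesgue ?U"
      using U by (intro emeasure_mono) auto
    then have "emeasure lebesgue (Rect_upper p \<gamma> R) < top"
      using assms(6) by auto
    then obtain m where m: "emeasure lebesgue (Rect_upper p \<gamma> R) = ennreal m" "0 \<le> m"
      by (cases "emeasure lebesgue (Rect_upper p \<gamma> R)") auto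
    with emeasure_Rect_upper_pos[OF R(1) assms(8)] have "0 < m"
      by simp
    then have "\<forall>\<^sub>F q in at_top. a < ennreal (b * m powr (1 / q))"
      using b b' by (intro order_tendstoD(1)[OF tendsto_mult_powr_inverse_at_top]) auto
    then show "\<forall>\<^sub>F q in at_top. a < PJN p q \<gamma> r ?U f"
      using eventually_gt_at_top[of 0]
    proof eventually_elim
      case (elim q)
      then show ?case
        using PJN_ge[OF _ R(1) m less_imp_le[OF R(2)] b(2), of q]
        by (auto intro: order.strict_trans2)
    qed
  next
    fix a assume "PBMO p \<gamma> r ?U f < a"
    then obtain b' where b': "PBMO p \<gamma> r ?U f < b'" "b' < a"
      using dense by blast
    have "0 < b'" "b' < top"
      using order.strict_trans1[OF zero_le b'(1)] order.strict_trans2[OF b'(2) top_greatest]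
      by blast+
    then obtain b where b: "b' = ennreal b" "0 < b"
      by (cases b') auto
    \<comment> \<open>The maximum with \<open>1\<close> makes \<open>M\<close> positive, as \<open>M\<^bsup>1/q\<^esup> \<rightarrow> 1\<close> requires.\<close>
    obtain M where M: "emeasure lebesgue ?U \<le> ennreal M" "0 < M"
    proof
      show "emeasure lebesgue ?U \<le> ennreal (max 1 (enn2real (emeasure lebesgue ?U)))"
        using assms(6) by (cases "emeasure lebesgue ?U") (auto intro: ennreal_leI)
    qed simp
    have "\<forall>\<^sub>F q in at_top. ennreal (b * M powr (1 / q)) < a"
      using b b' M by (intro order_tendstoD(2)[OF tendsto_mult_powr_inverse_at_top]) auto
    then show "\<forall>\<^sub>F q in at_top. PJN p q \<gamma> r ?U f < a"
      using eventually_gt_at_top[of 0]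
    proof eventually_elim
      case (elim q)
      then show ?case
        using PJN_le[OF assms(7) _ U M(1) _ _ b(2), of q p r f] M(2) b b'
        by (auto intro: order.strict_trans1)
    qed
  }
qed

end
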